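(* A digraph is $1$-extremal if and only if it is a directed cycle.
   Context: Digraphs are finite, without loops or parallel arcs, but may contain digons. A $k$-dicolouring of $D$ is a map $V(D)\to\{1,\dots,k\}$ in which every colour class induces an acyclic subdigraph; $\vec{\chi}(D)$ is the least $k$ for which one exists. $\lambda_D(x,y)$ is the maximum number of pairwise arc-disjoint directed $xy$-paths and $\lambda(D)=\max_{x\ne y}\lambda_D(x,y)$. $D$ is strong if there is a directed path between any ordered pair of vertices; $D$ is biconnected if its underlying undirected graph is connected and has no cutvertex. For $k\ge1$, $D$ is $k$-extremal if it is biconnected, strong, and $\vec{\chi}(D)=\lambda(D)+1=k+1$. *)

theory Defs
  imports "Graph_Theory.Digraph_Component"
begin

definition dicolouring :: "('a,'b) pre_digraph \<Rightarrow> nat \<Rightarrow> ('a \<Rightarrow> nat) \<Rightarrow> bool" where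
  "dicolouring D k c \<longleftrightarrow>
     (\<forall>v \<in> verts D. c v \<in> {1..k}) \<and>
     (\<forall>i \<in> {1..k}. \<not> (\<exists>p. pre_digraph.cycle (D \<restriction> {v \<in> verts D. c v = i}) p))"

definition dichromatic_number :: "('a,'b) pre_digraph \<Rightarrow> nat" where
  "dichromatic_number D = (LEAST k. \<exists>c. dicolouring D k c)"

definition arc_disjoint_paths :: "('a,'b) pre_digraph \<Rightarrow> 'a \<Rightarrow> 'a \<Rightarrow> 'b awalk set \<Rightarrow> bool" where
  "arc_disjoint_paths D x y P \<longleftrightarrow>
     (\<forall>p \<in> P. pre_digraph.apath D x p y) \<and> pairwise (\<lambda>p q. set p \<inter> set q = {}) P"

definition local_arc_connectivity :: "('a,'b) pre_digraph \<Rightarrow> 'a \<Rightarrow> 'a \<Rightarrow> nat" where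
  "local_arc_connectivity D x y = Max {card P | P. arc_disjoint_paths D x y P}"

text \<open>On a digraph with at most one vertex this is the unspecified value \<open>Max {}\<close>. Such a
  digraph has dichromatic number at most 1, so it is not \<open>k\<close>-extremal for any \<open>k \<ge> 1\<close>, whatever
  that value is.\<close>

definition max_local_arc_connectivity :: "('a,'b) pre_digraph \<Rightarrow> nat" where
  "max_local_arc_connectivity D =
     Max {local_arc_connectivity D x y | x y. x \<in> verts D \<and> y \<in> verts D \<and> x \<noteq> y}"

text \<open>An undirected graph is represented by a symmetric digraph, as in the library, where
  \<^const>\<open>mk_symmetric\<close> is the underlying undirected graph. A cutvertex separates two other
  vertices of its component; in particular a one-vertex graph has none, although
  \<^const>\<open>connected\<close> fails for the empty graph that deleting its vertex leaves.\<close>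

definition cutvertex :: "('a,'b) pre_digraph \<Rightarrow> 'a \<Rightarrow> bool" where
  "cutvertex G v \<longleftrightarrow> v \<in> verts G \<and>
     (\<exists>x \<in> verts G - {v}. \<exists>y \<in> verts G - {v}.
        x \<rightarrow>\<^sup>*\<^bsub>G\<^esub> y \<and> \<not> x \<rightarrow>\<^sup>*\<^bsub>pre_digraph.del_vert G v\<^esub> y)"

definition biconnected :: "('a,'b) pre_digraph \<Rightarrow> bool" where
  "biconnected D \<longleftrightarrow> connected D \<and> \<not> (\<exists>v. cutvertex (with_proj (mk_symmetric D)) v)"

definition extremal :: "nat \<Rightarrow> ('a,'b) pre_digraph \<Rightarrow> bool" where
  "extremal k D \<longleftrightarrow> 1 \<le> k \<and> biconnected D \<and> strongly_connected D \<and>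
     dichromatic_number D = max_local_arc_connectivity D + 1 \<and>
     max_local_arc_connectivity D + 1 = k + 1"

text \<open>The digraph as a whole is a directed cycle. In a loopless digraph such a cycle has length
  at least 2; length 2 is the digon.\<close>

definition directed_cycle :: "('a,'b) pre_digraph \<Rightarrow> bool" where
  "directed_cycle D \<longleftrightarrow>
     (\<exists>p. pre_digraph.cycle D p \<and> arcs D = set p \<and> verts D = tail D ` set p)"

end

theory Submission
  imports Defs
begin

text \<open>
  Let \<open>D\<close> be strong and biconnected with \<open>\<lambda>(D) = 1\<close>, and let \<open>C\<close> be a cycle of \<open>D\<close>, which exists
  because one colour does not suffice. No path that avoids the arcs of \<open>C\<close> joins two distinct
  vertices of \<open>C\<close>, as it would be arc-disjoint from a path along \<open>C\<close>. By strong connectivity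
  every vertex is reached from \<open>C\<close> and reaches \<open>C\<close> without arcs of \<open>C\<close>. So the vertices reached in
  this way from different \<open>u \<in> C\<close> form disjoint sets that cover \<open>D\<close>, and such a set is joined to the
  rest only through \<open>u\<close>. As \<open>u\<close> is not a cutvertex, the set is \<open>{u}\<close>, hence \<open>D = C\<close>.

  Conversely, a directed cycle is strong and all its out-degrees are one. Hence all paths from
  \<open>x\<close> to \<open>y \<noteq> x\<close> share their first arc, and a cycle passes through every vertex, so giving one
  vertex a colour of its own yields a 2-dicolouring.
\<close>

section \<open>Walks and reachability\<close>

context wf_digraph
begin

text \<open>Reachability within an arc set \<open>A\<close> is a relation on vertices. Paths from
  disjoint arc sets are then arc-disjoint automatically.\<close>

lemma rtrancl_arcs_imp_apath:
  assumes "(u, v) \<in> (arc_to_ends G ` A)\<^sup>*" "A \<subseteq> arcs G" "v \<in> verts G"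
  shows "\<exists>q. apath u q v \<and> set q \<subseteq> A"
proof -
  from assms(1) have "\<exists>q. awalk u q v \<and> set q \<subseteq> A"
  proof (induction rule: converse_rtrancl_induct)
    case base
    show ?case using \<open>v \<in> verts G\<close> by (intro exI[of _ "[]"]) (simp add: awalk_Nil_iff)
  next
    case (step x y)
    then obtain q e where "awalk y q v" "set q \<subseteq> A" "e \<in> A" "tail G e = x" "head G e = y"
      by (auto simp: arc_to_ends_def)
    then show ?case using \<open>A \<subseteq> arcs G\<close>
      by (intro exI[of _ "e # q"]) (auto simp: awalk_Cons_iff)
  qed
  then obtain q where "awalk u q v" "set q \<subseteq> A" by blast
  then show ?thesis
    using apath_awalk_to_apath awalk_to_apath_subset by (meson subset_trans)
qed

lemma awalk_verts_rtrancl_arcs: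
  assumes "awalk u p v" "w \<in> set (awalk_verts u p)"
  shows "(u, w) \<in> (arc_to_ends G ` set p)\<^sup>* \<and> (w, v) \<in> (arc_to_ends G ` set p)\<^sup>*"
  using assms
proof (induction p arbitrary: u w)
  case Nil
  then show ?case by (auto simp: awalk_Nil_iff)
next
  case (Cons e p)
  have mono: "(arc_to_ends G ` set p)\<^sup>* \<subseteq> (arc_to_ends G ` set (e # p))\<^sup>*"
    by (intro rtrancl_mono) auto
  have walk: "awalk (head G e) p v" and step: "(u, head G e) \<in> arc_to_ends G ` set (e # p)"
    using Cons.prems(1) by (auto simp: awalk_Cons_iff arc_to_ends_def)
  have "head G e \<in> set (awalk_verts (head G e) p)"
    using walk hd_in_awalk_verts by blast
  then have to_v: "(head G e, v) \<in> (arc_to_ends G ` set (e # p))\<^sup>*"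
    using Cons.IH[OF walk] subsetD[OF mono] by simp
  consider "w = u" | "w \<in> set (awalk_verts (head G e) p)"
    using Cons.prems by (auto simp: awalk_Cons_iff)
  then show ?case
  proof cases
    case 1
    then show ?thesis using step to_v by (simp add: converse_rtrancl_into_rtrancl)
  next
    case 2
    then have "(head G e, w) \<in> (arc_to_ends G ` set (e # p))\<^sup>*"
      "(w, v) \<in> (arc_to_ends G ` set (e # p))\<^sup>*"
      using Cons.IH[OF walk] subsetD[OF mono] by simp_all
    then show ?thesis using converse_rtrancl_into_rtrancl[OF step] by simp
  qed
qed

text \<open>Both sides are the vertex set of the walk: a vertex other than the last is a tail, one
  other than the first is a head.\<close>

lemma cas_tails_heads:
  "cas u p v \<Longrightarrow> insert v (tail G ` set p) = insert u (head G ` set p)"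
proof (induction p arbitrary: u)
  case (Cons e p)
  then have "insert v (tail G ` set p) = insert (head G e) (head G ` set p)" "tail G e = u"
    by auto
  then show ?case by auto
qed simp

lemma closed_awalk_heads_eq_tails:
  assumes "awalk u p u" "p \<noteq> []"
  shows "head G ` set p = tail G ` set p"
proof -
  have "insert u (tail G ` set p) = insert u (head G ` set p)"
    using assms cas_tails_heads by blast
  moreover have "u \<in> tail G ` set p"
    using assms by (cases p) (auto simp: awalk_Cons_iff)
  moreover have "u \<in> head G ` set p"
    using assms by (cases p rule: rev_cases) (auto simp: awalk_Cons_iff)
  ultimately show ?thesis by (simp add: insert_absorb)
qed

lemma cycle_heads_eq_tails: "cycle p \<Longrightarrow> head G ` set p = tail G ` set p"
  by (auto simp: cycle_def dest: closed_awalk_heads_eq_tails)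

text \<open>Go from \<open>x\<close> along the cycle to its base vertex \<open>u\<close>, and from
  there on to \<open>y\<close>.\<close>

lemma cycle_rtrancl_arcs:
  assumes "cycle p" "x \<in> tail G ` set p" "y \<in> tail G ` set p"
  shows "(x, y) \<in> (arc_to_ends G ` set p)\<^sup>*"
proof -
  obtain u where u: "awalk u p u" using assms(1) by (auto simp: cycle_def)
  have "x \<in> set (awalk_verts u p)" "y \<in> set (awalk_verts u p)"
    using assms u by (auto simp: set_awalk_verts)
  then show ?thesis using awalk_verts_rtrancl_arcs[OF u] by (meson rtrancl_trans)
qed

lemma tl_awalk_verts: "cas u p v \<Longrightarrow> tl (awalk_verts u p) = map (head G) p"
proof (induction p arbitrary: u)
  case (Cons e p)
  then show ?case by (cases p) auto
qed simp

text \<open>Distinctness in \<open>cycle\<close> concerns the heads. It passes to the tails by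
  counting, since heads and tails form the same set.\<close>

lemma cycle_inj_on_tail:
  assumes "cycle p"
  shows "inj_on (tail G) (set p)"
proof (rule eq_card_imp_inj_on)
  obtain u where "awalk u p u" "distinct (tl (awalk_verts u p))"
    using assms by (auto simp: cycle_def)
  then have "inj_on (head G) (set p)"
    using tl_awalk_verts by (metis awalk_def distinct_map)
  then have "card (head G ` set p) = card (set p)" by (rule card_image)
  then show "card (tail G ` set p) = card (set p)"
    using cycle_heads_eq_tails[OF assms] by simp
qed simp

text \<open>Stop at the first vertex in \<open>C\<close>: every earlier arc has its tail outside
  \<open>C\<close>, so it is not in \<open>A\<close>.\<close>

lemma rtrancl_until_first:
  assumes "(w, c) \<in> (arc_to_ends G ` arcs G)\<^sup>*" "c \<in> C" "tail G ` A \<subseteq> C"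
  shows "\<exists>c'\<in>C. (w, c') \<in> (arc_to_ends G ` (arcs G - A))\<^sup>*"
  using assms(1)
proof (induction rule: converse_rtrancl_induct)
  case base
  then show ?case using assms(2) by blast
next
  case (step x y)
  show ?case
  proof (cases "x \<in> C")
    case False
    then have "(x, y) \<in> arc_to_ends G ` (arcs G - A)"
      using step.hyps(1) assms(3) by (auto simp: arc_to_ends_def)
    then show ?thesis using step.IH by (meson converse_rtrancl_into_rtrancl)
  qed blast
qed

text \<open>Dually, start at the last vertex in \<open>C\<close>: every later arc has its head
  outside \<open>C\<close>.\<close>

lemma rtrancl_from_last:
  assumes "(c, w) \<in> (arc_to_ends G ` arcs G)\<^sup>*" "c \<in> C" "head G ` A \<subseteq> C"
  shows "\<exists>c'\<in>C. (c', w) \<in> (arc_to_ends G ` (arcs G - A))\<^sup>*"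
  using assms(1)
proof (induction rule: rtrancl_induct)
  case base
  then show ?case using assms(2) by blast
next
  case (step x y)
  show ?case
  proof (cases "y \<in> C")
    case False
    then have "(x, y) \<in> arc_to_ends G ` (arcs G - A)"
      using step.hyps(2) assms(3) by (auto simp: arc_to_ends_def)
    then show ?thesis using step.IH by (meson rtrancl_into_rtrancl)
  qed blast
qed

lemma strongly_connected_rtrancl_arcs:
  "strongly_connected G \<Longrightarrow> x \<in> verts G \<Longrightarrow> y \<in> verts G \<Longrightarrow> (x, y) \<in> (arc_to_ends G ` arcs G)\<^sup>*"
  using reachable_conv'[of x y] by (auto simp: strongly_connected_def arcs_ends_def)

lemma arcs_ends_del_vert_mk_symmetric:
  "arcs_ends (pre_digraph.del_vert (with_proj (mk_symmetric G)) v) =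
     (\<Union>e \<in> {e \<in> arcs G. tail G e \<noteq> v \<and> head G e \<noteq> v}.
        {(tail G e, head G e), (head G e, tail G e)})"
  by (auto simp: arcs_ends_conv pre_digraph.del_vert_def parcs_mk_symmetric image_iff)

text \<open>Once \<open>v\<close> is deleted no edge leaves \<open>W\<close>, so \<open>y\<close> is
  no longer reachable from \<open>x\<close>.\<close>

lemma cutvertex_mk_symmetricI:
  assumes "connected G" "v \<in> verts G"
    and "x \<in> W" "x \<in> verts G - {v}" "y \<notin> W" "y \<in> verts G - {v}"
    and closed: "\<And>e. e \<in> arcs G \<Longrightarrow> tail G e \<noteq> v \<Longrightarrow> head G e \<noteq> v \<Longrightarrow> tail G e \<in> W \<longleftrightarrow> head G e \<in> W"
  shows "cutvertex (with_proj (mk_symmetric G)) v"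
proof -
  let ?S = "with_proj (mk_symmetric G)"
  have "z \<in> W" if "x \<rightarrow>\<^sup>*\<^bsub>pre_digraph.del_vert ?S v\<^esub> z" for z
    using reachable_rtranclI[OF that]
  proof (induction rule: rtrancl_induct)
    case base
    show ?case by fact
  next
    case (step a b)
    then show ?case using closed by (auto simp: arcs_ends_del_vert_mk_symmetric)
  qed
  moreover have "x \<rightarrow>\<^sup>*\<^bsub>?S\<^esub> y"
    using assms by (auto simp: connected_def strongly_connected_def)
  ultimately show ?thesis
    using assms(2-6) unfolding cutvertex_def by (intro conjI bexI[of _ x] bexI[of _ y]) auto
qed

end

section \<open>Local arc-connectivity\<close>

context fin_digraph
begin

text \<open>\<open>Max\<close> is only meaningful on finite sets; here there are finitely many
  paths, hence finitely many families of them.\<close>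

lemma finite_card_arc_disjoint_paths: "finite {card P | P. arc_disjoint_paths G x y P}"
proof (rule finite_subset)
  show "{card P | P. arc_disjoint_paths G x y P} \<subseteq> card ` Pow {p. apath x p y}"
    by (auto simp: arc_disjoint_paths_def)
qed (simp add: apaths_finite)

lemma finite_local_arc_connectivities:
  "finite {local_arc_connectivity G x y | x y. x \<in> verts G \<and> y \<in> verts G \<and> x \<noteq> y}"
proof (rule finite_subset)
  show "{local_arc_connectivity G x y | x y. x \<in> verts G \<and> y \<in> verts G \<and> x \<noteq> y}
      \<subseteq> (\<lambda>(x, y). local_arc_connectivity G x y) ` (verts G \<times> verts G)"
    by auto
qed simp

lemma card_le_max_local_arc_connectivity:
  assumes "arc_disjoint_paths G x y P" "x \<in> verts G" "y \<in> verts G" "x \<noteq> y"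
  shows "card P \<le> max_local_arc_connectivity G"
proof -
  have "card P \<le> local_arc_connectivity G x y"
    unfolding local_arc_connectivity_def
    using assms(1) by (intro Max_ge finite_card_arc_disjoint_paths) blast
  also have "\<dots> \<le> max_local_arc_connectivity G"
    unfolding max_local_arc_connectivity_def
    using assms(2-4) by (intro Max_ge finite_local_arc_connectivities) blast
  finally show ?thesis .
qed

end

lemma apath_neq_Nil: "pre_digraph.apath D x p y \<Longrightarrow> x \<noteq> y \<Longrightarrow> p \<noteq> []"
  by (auto simp: pre_digraph.apath_def pre_digraph.awalk_def pre_digraph.cas.simps)

section \<open>Digraphs of dichromatic number two\<close>

lemma dichromatic_number_le: "dicolouring D k c \<Longrightarrow> dichromatic_number D \<le> k"
  unfolding dichromatic_number_def by (rule Least_le) blast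

lemma (in wf_digraph) induce_subgraph_verts_eq: "G \<restriction> verts G = G"
  by (rule pre_digraph.equality) auto

text \<open>In an acyclic digraph the constant map is a dicolouring with one colour.\<close>

lemma (in wf_digraph) cycle_if_dichromatic_number_gt_1:
  assumes "dichromatic_number G > 1"
  shows "\<exists>p. cycle p"
proof (rule ccontr)
  assume "\<nexists>p. cycle p"
  then have "dicolouring G 1 (\<lambda>_. 1)"
    by (simp add: dicolouring_def induce_subgraph_verts_eq)
  then show False using dichromatic_number_le assms by fastforce
qed

section \<open>Extremal digraphs are directed cycles\<close>

lemma (in digraph) directed_cycle_if_max_local_arc_connectivity_1:
  assumes bi: "biconnected G" and strong: "strongly_connected G"
    and conn: "max_local_arc_connectivity G = 1" and p: "cycle p"
  shows "directed_cycle G"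
proof -
  define C where "C = tail G ` set p"
  \<comment> \<open>\<open>R\<close> is reachability off the cycle; it is reflexive.\<close>
  define R where "R = (arc_to_ends G ` (arcs G - set p))\<^sup>*"
  have p_arcs: "set p \<subseteq> arcs G" and "p \<noteq> []" using p by (auto simp: cycle_def)
  have C_verts: "C \<subseteq> verts G" using p_arcs by (auto simp: C_def)
  have heads: "head G ` set p = C" using cycle_heads_eq_tails[OF p] by (simp add: C_def)
  have R_trans: "(a, c) \<in> R" if "(a, b) \<in> R" "(b, c) \<in> R" for a b c
    using that unfolding R_def by (rule rtrancl_trans)
  have R_arc: "(tail G e, head G e) \<in> R" if "e \<in> arcs G" "e \<notin> set p" for e
    using that unfolding R_def by (auto simp: arc_to_ends_def)
  \<comment> \<open>Otherwise a path along the cycle and a path off the cycle are arc-disjoint.\<close>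
  have R_C: "x = y" if xy: "x \<in> C" "y \<in> C" "(x, y) \<in> R" for x y
  proof (rule ccontr)
    assume "x \<noteq> y"
    have "y \<in> verts G" "x \<in> verts G" using xy C_verts by auto
    obtain q1 where q1: "apath x q1 y" "set q1 \<subseteq> arcs G - set p"
      using rtrancl_arcs_imp_apath[of x y "arcs G - set p"] xy(3) \<open>y \<in> verts G\<close>
      by (auto simp: R_def)
    obtain q2 where q2: "apath x q2 y" "set q2 \<subseteq> set p"
      using rtrancl_arcs_imp_apath[OF cycle_rtrancl_arcs[OF p] p_arcs \<open>y \<in> verts G\<close>] xy(1,2)
      by (auto simp: C_def)
    have "q1 \<noteq> []" using q1(1) \<open>x \<noteq> y\<close> by (rule apath_neq_Nil)
    then have "q1 \<noteq> q2" using q1(2) q2(2) by (cases q1) auto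
    have "arc_disjoint_paths G x y {q1, q2}"
      unfolding arc_disjoint_paths_def pairwise_def using q1 q2 by blast
    from card_le_max_local_arc_connectivity[OF this \<open>x \<in> verts G\<close> \<open>y \<in> verts G\<close> \<open>x \<noteq> y\<close>]
    show False using conn \<open>q1 \<noteq> q2\<close> by simp
  qed
  have R_to_C: "\<exists>c\<in>C. (w, c) \<in> R" and R_from_C: "\<exists>c\<in>C. (c, w) \<in> R" if "w \<in> verts G" for w
  proof -
    obtain c where "c \<in> C" using \<open>p \<noteq> []\<close> by (cases p) (auto simp: C_def)
    then have "c \<in> verts G" using C_verts by blast
    show "\<exists>c\<in>C. (w, c) \<in> R" unfolding R_def
      using strongly_connected_rtrancl_arcs[OF strong that \<open>c \<in> verts G\<close>] \<open>c \<in> C\<close>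
      by (rule rtrancl_until_first) (simp add: C_def)
    show "\<exists>c\<in>C. (c, w) \<in> R" unfolding R_def
      using strongly_connected_rtrancl_arcs[OF strong \<open>c \<in> verts G\<close> that] \<open>c \<in> C\<close>
      by (rule rtrancl_from_last) (simp add: heads)
  qed
  have R_verts: "w \<in> verts G" if "(u, w) \<in> R" "u \<in> C" for u w
    using that(1) unfolding R_def
    by (cases rule: rtranclE) (use that(2) C_verts in \<open>auto simp: arc_to_ends_def\<close>)
  \<comment> \<open>The part of the digraph hanging off the cycle at \<open>u\<close> is separated from the rest by \<open>u\<close>.\<close>
  have R_trivial: "w = u" if u: "u \<in> C" and w: "(u, w) \<in> R" for u w
  proof (rule ccontr)
    assume "w \<noteq> u"
    \<comment> \<open>From \<open>b\<close> some \<open>c\<close> in \<open>C\<close> is reached off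
      the cycle, hence also from \<open>u\<close>; so \<open>c = u\<close>.\<close>
    have R_back: "(b, u) \<in> R" if b: "(u, b) \<in> R" for b
    proof -
      obtain c where "c \<in> C" "(b, c) \<in> R" using R_to_C R_verts[OF b u] by blast
      then show ?thesis using R_C[OF u, of c] R_trans[OF b] by blast
    qed
    obtain e where e: "e \<in> set p" "tail G e = u" using u by (auto simp: C_def)
    \<comment> \<open>The successor of \<open>u\<close> on the cycle witnesses the other side of the
      cut.\<close>
    define y where "y = head G e"
    have y: "y \<in> C" "y \<noteq> u" using e p_arcs heads no_loops[of e] by (auto simp: y_def)
    have "cutvertex (with_proj (mk_symmetric G)) u"
    proof (rule cutvertex_mk_symmetricI[where W = "{w. (u, w) \<in> R}" and x = w and y = y])
      fix a assume a: "a \<in> arcs G" "tail G a \<noteq> u" "head G a \<noteq> u"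
      show "tail G a \<in> {w. (u, w) \<in> R} \<longleftrightarrow> head G a \<in> {w. (u, w) \<in> R}"
      proof (cases "a \<in> set p")
        \<comment> \<open>Both ends lie in \<open>C\<close> and differ from \<open>u\<close>, so
          neither is reached from \<open>u\<close> off the cycle.\<close>
        case True
        then have "tail G a \<in> C" "head G a \<in> C" using heads by (auto simp: C_def)
        then show ?thesis using R_C[OF u] a by auto
      next
        case False
        note arc = R_arc[OF a(1) False]
        \<comment> \<open>Some \<open>c\<close> in \<open>C\<close> reaches the tail, then the head,
          then \<open>u\<close>, all off the cycle; so \<open>c = u\<close>.\<close>
        have "(u, tail G a) \<in> R" if h: "(u, head G a) \<in> R"
        proof -
          obtain c where c: "c \<in> C" "(c, tail G a) \<in> R" using R_from_C[of "tail G a"] a(1) by auto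
          have "(c, u) \<in> R" using c(2) arc R_back[OF h] R_trans by blast
          then show ?thesis using R_C[OF c(1) u] c(2) by simp
        qed
        then show ?thesis using arc R_trans by auto
      qed
    qed (use bi u w y C_verts R_C R_verts \<open>w \<noteq> u\<close> in \<open>auto simp: biconnected_def\<close>)
    then show False using bi by (auto simp: biconnected_def)
  qed
  have "verts G \<subseteq> C" using R_from_C R_trivial by blast
  moreover have "arcs G \<subseteq> set p"
  proof
    fix e assume e: "e \<in> arcs G"
    show "e \<in> set p"
    proof (rule ccontr)
      \<comment> \<open>An arc off the cycle would have to be a loop.\<close>
      assume "e \<notin> set p"
      moreover have "tail G e \<in> C" using \<open>verts G \<subseteq> C\<close> e by auto
      ultimately have "head G e = tail G e" using R_arc[OF e] R_trivial by blast
      then show False using no_loops[OF e] by simp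
    qed
  qed
  ultimately show ?thesis
    using p p_arcs C_verts unfolding directed_cycle_def C_def by blast
qed

section \<open>Directed cycles are extremal\<close>

locale directed_cycle_digraph = digraph +
  fixes p
  assumes cycle_p: "cycle p" and arcs_eq: "arcs G = set p" and verts_eq: "verts G = tail G ` set p"
begin

text \<open>Out-degrees are at most one; the rest of the converse builds on this.\<close>

lemma tail_inj: "e \<in> arcs G \<Longrightarrow> e' \<in> arcs G \<Longrightarrow> tail G e = tail G e' \<Longrightarrow> e = e'"
  using cycle_inj_on_tail[OF cycle_p] by (auto simp: arcs_eq inj_on_def)

lemma ex_out_arc: "v \<in> verts G \<Longrightarrow> \<exists>e\<in>arcs G. tail G e = v"
  by (auto simp: verts_eq arcs_eq)

lemma rtrancl_all: "x \<in> verts G \<Longrightarrow> y \<in> verts G \<Longrightarrow> (x, y) \<in> (arc_to_ends G ` arcs G)\<^sup>*"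
  using cycle_rtrancl_arcs[OF cycle_p] by (simp add: verts_eq arcs_eq)

lemma verts_nonempty: "verts G \<noteq> {}"
  using cycle_p by (auto simp: verts_eq cycle_def)

lemma strong: "strongly_connected G"
  using verts_nonempty rtrancl_all by (auto simp: reachable_conv' arcs_ends_def)

lemma connected: "connected G"
  using strong reachable_mk_symmetricI by (auto simp: connected_def strongly_connected_def)

lemma no_cutvertex: "\<not> cutvertex (with_proj (mk_symmetric G)) v"
proof
  let ?S = "with_proj (mk_symmetric G)" and ?H = "pre_digraph.del_vert (with_proj (mk_symmetric G)) v"
  assume cut: "cutvertex ?S v"
  then have v: "v \<in> verts G" by (simp add: cutvertex_def)
  interpret S: pair_wf_digraph "mk_symmetric G" ..
  interpret H: wf_digraph ?H by (rule S.wf_digraph_del_vert)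
  obtain e where e: "e \<in> arcs G" "tail G e = v" using ex_out_arc[OF v] by blast
  have sym: "sym (arcs_ends ?H)"
    by (auto simp: sym_def arcs_ends_del_vert_mk_symmetric)
  \<comment> \<open>The unique out-neighbour of \<open>v\<close> reaches every vertex without using \<open>v\<close>.\<close>
  have from_succ: "(head G e, w) \<in> (arcs_ends ?H)\<^sup>*" if "w \<in> verts G" "w \<noteq> v" for w
    using rtrancl_all[OF v that(1)] that(2)
  proof (induction rule: rtrancl_induct)
    case (step a b)
    then obtain f where f: "f \<in> arcs G" "tail G f = a" "head G f = b"
      by (auto simp: arc_to_ends_def)
    show ?case
    proof (cases "a = v")
      \<comment> \<open>Any arc leaving \<open>v\<close> is \<open>e\<close>, so the walk can be
        restarted at \<open>head G e\<close>.\<close>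
      case True
      then show ?thesis using tail_inj[OF f(1) e(1)] f e by simp
    next
      case False
      then have "(a, b) \<in> arcs_ends ?H"
        using f step.prems by (auto simp: arcs_ends_del_vert_mk_symmetric)
      then show ?thesis using step.IH[OF False] by (rule rtrancl_into_rtrancl[rotated])
    qed
  qed simp
  have "x \<rightarrow>\<^sup>*\<^bsub>?H\<^esub> y" if "x \<in> verts ?S - {v}" "y \<in> verts ?S - {v}" for x y
  proof -
    \<comment> \<open>By symmetry, \<open>x\<close> and \<open>y\<close> are connected through
      \<open>head G e\<close>.\<close>
    have "(x, head G e) \<in> (arcs_ends ?H)\<^sup>*"
      using from_succ[of x] that sym_rtrancl[OF sym] by (auto dest: symD)
    then have "(x, y) \<in> (arcs_ends ?H)\<^sup>*" using from_succ[of y] that by auto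
    then show ?thesis using that by (subst H.reachable_conv') (auto simp: S.del_vert_simps)
  qed
  then show False using cut unfolding cutvertex_def by blast
qed

lemma biconnected: "biconnected G"
  using connected no_cutvertex by (simp add: biconnected_def)

lemma local_arc_connectivity_eq_1:
  assumes "x \<in> verts G" "y \<in> verts G" "x \<noteq> y"
  shows "local_arc_connectivity G x y = 1"
  unfolding local_arc_connectivity_def
proof (rule Max_eqI[OF finite_card_arc_disjoint_paths])
  obtain e where e: "e \<in> arcs G" "tail G e = x" using ex_out_arc assms(1) by blast
  have first: "e \<in> set q" if q: "apath x q y" for q
  proof -
    obtain f q' where "q = f # q'" using apath_neq_Nil[OF q assms(3)] by (meson neq_Nil_conv)
    then show ?thesis using q e tail_inj[of f e] by (auto simp: apath_Cons_iff)
  qed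
  fix n assume "n \<in> {card P | P. arc_disjoint_paths G x y P}"
  then obtain P where P: "arc_disjoint_paths G x y P" "n = card P" by blast
  have "q = q'" if "q \<in> P" "q' \<in> P" for q q'
    using P(1) that first unfolding arc_disjoint_paths_def pairwise_def by blast
  \<comment> \<open>An infinite \<open>P\<close> has \<open>card P = 0\<close>.\<close>
  then show "n \<le> 1"
    using P(2) card_le_Suc0_iff_eq[of P] by (cases "finite P") auto
next
  obtain q where "apath x q y"
    using rtrancl_arcs_imp_apath[OF rtrancl_all[OF assms(1,2)]] assms by blast
  then have "arc_disjoint_paths G x y {q}" by (simp add: arc_disjoint_paths_def)
  then show "1 \<in> {card P | P. arc_disjoint_paths G x y P}" by force
qed

lemma max_local_arc_connectivity_eq_1: "max_local_arc_connectivity G = 1"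
proof -
  obtain e where "e \<in> arcs G" using verts_nonempty ex_out_arc by blast
  then have e: "tail G e \<in> verts G" "head G e \<in> verts G" "tail G e \<noteq> head G e"
    using no_loops by auto
  then have "1 \<in> {local_arc_connectivity G x y | x y. x \<in> verts G \<and> y \<in> verts G \<and> x \<noteq> y}"
    using local_arc_connectivity_eq_1[OF e] by (metis (mono_tags, lifting) mem_Collect_eq)
  then have "{local_arc_connectivity G x y | x y. x \<in> verts G \<and> y \<in> verts G \<and> x \<noteq> y} = {1}"
    using local_arc_connectivity_eq_1 by auto
  then show ?thesis by (simp add: max_local_arc_connectivity_def)
qed

text \<open>The only arc leaving a vertex of \<open>q\<close> belongs to \<open>q\<close>, so the
  vertex set of \<open>q\<close> is closed under reachability.\<close>

lemma cycle_spanning: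
  assumes "cycle q"
  shows "verts G \<subseteq> tail G ` set q"
proof
  fix y assume y: "y \<in> verts G"
  have q: "set q \<subseteq> arcs G" "q \<noteq> []" using assms by (auto simp: cycle_def)
  then obtain x where x: "x \<in> tail G ` set q" by (cases q) auto
  then have "(x, y) \<in> (arc_to_ends G ` arcs G)\<^sup>*" using q y by (auto intro!: rtrancl_all)
  then show "y \<in> tail G ` set q"
  proof (induction rule: rtrancl_induct)
    case base
    show ?case by fact
  next
    case (step a b)
    then obtain e f where "e \<in> arcs G" "tail G e = a" "head G e = b" "f \<in> set q" "tail G f = a"
      by (auto simp: arc_to_ends_def)
    then have "e \<in> set q" using tail_inj[of e f] q by auto
    then show ?case using \<open>head G e = b\<close> cycle_heads_eq_tails[OF assms] by blast
  qed
qed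

lemma dichromatic_number_eq_2: "dichromatic_number G = 2"
  unfolding dichromatic_number_def
proof (rule Least_equality)
  obtain u where u: "u \<in> verts G" using verts_nonempty by blast
  define c where "c = (\<lambda>v. if v = u then 1 else 2 :: nat)"
  have "\<not> pre_digraph.cycle (G \<restriction> {v \<in> verts G. c v = i}) q" if "i \<in> {1..2}" for i q
  proof
    let ?V = "{v \<in> verts G. c v = i}"
    assume q: "pre_digraph.cycle (G \<restriction> ?V) q"
    then have "q \<noteq> []" and q_arcs: "set q \<subseteq> arcs (G \<restriction> ?V)"
      by (auto simp: pre_digraph.cycle_def pre_digraph.awalk_def)
    have "cycle q" using subgraph_cycle[OF subgraph_induce_subgraphI q] by blast
    then have "u \<in> tail G ` set q" using cycle_spanning u by blast
    \<comment> \<open>The cycle passes through \<open>u\<close>, so its colour class is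
      \<open>{u}\<close>, which carries no arcs.\<close>
    then have "i = 1" using q_arcs by (auto simp: c_def)
    then have "arcs (G \<restriction> ?V) = {}" using no_loops by (auto simp: c_def)
    then show False using q_arcs \<open>q \<noteq> []\<close> by (metis set_empty subset_empty)
  qed
  then have "dicolouring G 2 c" unfolding dicolouring_def by (auto simp: c_def)
  then show "\<exists>c. dicolouring G 2 c" by blast
next
  fix k assume "\<exists>c. dicolouring G k c"
  then obtain c where c: "dicolouring G k c" by blast
  show "2 \<le> k"
  proof (rule ccontr)
    assume "\<not> 2 \<le> k"
    then have "k = 0 \<or> k = 1" by auto
    \<comment> \<open>For \<open>k = 0\<close> the range \<open>{1..k}\<close> is empty, so no
      vertex could be coloured.\<close>
    moreover have "k \<noteq> 0" using c verts_nonempty by (auto simp: dicolouring_def)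
    ultimately have "k = 1" by simp
    then have "{v \<in> verts G. c v = 1} = verts G"
      using c by (auto simp: dicolouring_def)
    then have "G \<restriction> {v \<in> verts G. c v = 1} = G" using induce_subgraph_verts_eq by simp
    then show False using c \<open>k = 1\<close> cycle_p by (auto simp: dicolouring_def)
  qed
qed

lemma extremal: "extremal 1 G"
  using biconnected strong dichromatic_number_eq_2 max_local_arc_connectivity_eq_1
  by (simp add: extremal_def)

end

theorem theorem4p2:
  fixes D :: "('a,'b) pre_digraph"
  assumes "digraph D"
  shows "extremal 1 D \<longleftrightarrow> directed_cycle D"
proof
  interpret digraph D by fact
  assume "extremal 1 D"
  then have "biconnected D" "strongly_connected D" "dichromatic_number D = 2"
    "max_local_arc_connectivity D = 1"
    by (auto simp: extremal_def)
  then show "directed_cycle D"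
    using cycle_if_dichromatic_number_gt_1 directed_cycle_if_max_local_arc_connectivity_1 by fastforce
next
  interpret digraph D by fact
  assume "directed_cycle D"
  then obtain p where "cycle p" "arcs D = set p" "verts D = tail D ` set p"
    by (auto simp: directed_cycle_def)
  then interpret directed_cycle_digraph D p by unfold_locales
  show "extremal 1 D" by (rule extremal)
qed

end
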